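(* Let $\mathbf{F}=F(\mathcal{R}[t,t^{-1}])$, let $k>1$ and $d=2^{k-2}$. If $g\in\mathbf{F}^{(k)}$, the $k$-th derived subgroup of $\mathbf{F}$, then $g=I+\sum_{i\ge d}(t-1)^iA_i$ with $A_i\in M_2(\mathcal{R})$, and all entries of $A_i$ lie in $\Sigma^{2d}$ for every $i\ge d$.
   Context: $\mathcal{R}=\mathbb{Z}[x,x^{-1},y,y^{-1}]$; $\Sigma$ is the augmentation ideal of $\mathcal{R}$ (kernel of $x,y\mapsto1$ to $\mathbb{Z}$). $F(\mathcal{R}[t,t^{-1}])$ is the subgroup of $GL_2(\mathcal{R}[t,t^{-1}])$ generated by $M_1=\begin{pmatrix}1&1-y\\0&x\end{pmatrix}$ and $M_2T=\begin{pmatrix}yt&0\\1-xt&1\end{pmatrix}$. Via $t=1+s$, $t^{-1}=\sum_{i\ge0}(-s)^i$, $\mathcal{R}[t,t^{-1}]$ embeds in $\mathcal{R}[[s]]$, giving each matrix over $\mathcal{R}[t,t^{-1}]$ a unique expansion $\sum_{i\ge0}(t-1)^iA_i$ with $A_i$ matrices over $\mathcal{R}$. Derived series: $\mathbf{F}^{(1)}=\mathbf{F}'$, $\mathbf{F}^{(k+1)}=[\mathbf{F}^{(k)},\mathbf{F}^{(k)}]$. *)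

theory Defs
  imports "HOL-Analysis.Finite_Cartesian_Product" "HOL-Library.Poly_Mapping"
    "HOL-Library.Product_Plus"
    "HOL-Computational_Algebra.Formal_Power_Series" "HOL-Algebra.Solvable_Groups"
begin

text \<open>The ring R = Z[x,x^-1,y,y^-1] as the integral group ring of Z^2:
  finitely supported functions Z x Z -> Z with convolution product.
  The monomial x^a y^b is Poly_Mapping.single (a,b) 1.\<close>
type_synonym R = "(int \<times> int) \<Rightarrow>\<^sub>0 int"

definition xR :: R where "xR = Poly_Mapping.single (1,0) 1"
definition yR :: R where "yR = Poly_Mapping.single (0,1) 1"

text \<open>Augmentation map x,y -> 1 and augmentation ideal Sigma.\<close>
definition augR :: "R \<Rightarrow> int" where
  "augR p = (\<Sum>m\<in>Poly_Mapping.keys p. Poly_Mapping.lookup p m)"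

definition Sigma_ideal :: "R set" where
  "Sigma_ideal = {p. augR p = 0}"

text \<open>Powers of an ideal: I^0 = R, I^(n+1) = I^n * I (finite sums of products).\<close>
fun ideal_power :: "'a::comm_ring_1 set \<Rightarrow> nat \<Rightarrow> 'a set" where
  "ideal_power I 0 = UNIV"
| "ideal_power I (Suc n) =
     {(\<Sum>j<m. a j * b j) | (m::nat) a b. \<forall>j<m. a j \<in> ideal_power I n \<and> b j \<in> I}"

text \<open>The Laurent polynomial ring R[t,t^-1] as finitely supported functions Z -> R;
  t^n * r is Poly_Mapping.single n r.\<close>
type_synonym RT = "int \<Rightarrow>\<^sub>0 R"

definition tT :: RT where "tT = Poly_Mapping.single 1 1"
definition constT :: "R \<Rightarrow> RT" where "constT r = Poly_Mapping.single 0 r"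

text \<open>Embedding R[t,t^-1] -> R[[s]] via t = 1 + s, t^-1 = sum_i (-s)^i.\<close>
definition tinv_fps :: "R fps" where "tinv_fps = Abs_fps (\<lambda>i. (-1) ^ i)"

definition tpow_fps :: "int \<Rightarrow> R fps" where
  "tpow_fps n = (if 0 \<le> n then (1 + fps_X) ^ nat n else tinv_fps ^ nat (- n))"

definition embed_fps :: "RT \<Rightarrow> R fps" where
  "embed_fps p = (\<Sum>n\<in>Poly_Mapping.keys p. fps_const (Poly_Mapping.lookup p n) * tpow_fps n)"

text \<open>2x2 matrices.\<close>
definition mat2 :: "'a \<Rightarrow> 'a \<Rightarrow> 'a \<Rightarrow> 'a \<Rightarrow> 'a^2^2" where
  "mat2 a b c d = (\<chi> i j. if i = 1 then (if j = 1 then a else b) else (if j = 1 then c else d))"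

text \<open>GL_2 over a commutative ring, as a monoid structure (invertible matrices).\<close>
definition GL2 :: "('a::comm_ring_1^2^2) monoid" where
  "GL2 = \<lparr>carrier = {A. \<exists>B. A ** B = mat 1 \<and> B ** A = mat 1},
          mult = (**), one = mat 1\<rparr>"

definition M1 :: "RT^2^2" where
  "M1 = mat2 1 (constT (1 - yR)) 0 (constT xR)"

definition M2T :: "RT^2^2" where
  "M2T = mat2 (constT yR * tT) 0 (1 - constT xR * tT) 1"

text \<open>The group F(R[t,t^-1]) generated by M1 and M2T inside GL_2(R[t,t^-1]).\<close>
definition Fgrp :: "(RT^2^2) set" where
  "Fgrp = generate GL2 {M1, M2T}"

text \<open>k-th derived subgroup F^(k) (F^(0) = F).\<close>
definition Fderived :: "nat \<Rightarrow> (RT^2^2) set" where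
  "Fderived k = (derived GL2 ^^ k) Fgrp"

text \<open>The coefficient matrix A_i of (t-1)^i in the expansion g = sum_i (t-1)^i A_i.\<close>
definition coeff_mat :: "RT^2^2 \<Rightarrow> nat \<Rightarrow> R^2^2" where
  "coeff_mat g i = (\<chi> a b. fps_nth (embed_fps (g $ a $ b)) i)"

end

theory Submission imports Defs "HOL-Analysis.Determinants" begin

text \<open>
  Expand in \<open>s = t - 1\<close> and look at two shadows of a matrix in \<open>F\<close>: its value at \<open>t = 1\<close> and
  its image under the augmentation \<open>x, y \<mapsto> 1\<close>. At \<open>t = 1\<close> both generators have the form
  \<open>I + u r\<^sup>T\<close> with \<open>u = (1 - y, x - 1)\<close>, and such matrices are closed under products and
  inverses; after augmentation both become \<open>[[c, 0], [1 - c, 1]]\<close>, and these commute. So an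
  element of \<open>F'\<close> has trivial augmentation, i.e. all its coefficients lie in \<open>\<Sigma>\<close>, and its value
  at \<open>t = 1\<close> is \<open>I + u r\<^sup>T\<close> with determinant \<open>1 + r\<^sup>T u = 1\<close>. For two such matrices
  \<open>(A - I)(B - I)\<close> vanishes at \<open>t = 1\<close>, hence commutators of \<open>F'\<close> are \<open>I\<close> plus a matrix with
  coefficients in \<open>\<Sigma>\<^sup>2\<close> divisible by \<open>s\<close>. From there on, the identity
  \<open>[A, B] - I = ((A - I)(B - I) - (B - I)(A - I)) A\<^sup>-\<^sup>1 B\<^sup>-\<^sup>1\<close> doubles both the power of \<open>\<Sigma>\<close>
  and the order in \<open>s\<close> at each step of the derived series.
\<close>

section \<open>Ring homomorphisms and the group \<open>GL\<^sub>2\<close>\<close>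

locale comm_ring_hom =
  fixes hom :: "'a::comm_ring_1 \<Rightarrow> 'b::comm_ring_1"
  assumes hom_add: "hom (a + b) = hom a + hom b"
    and hom_mult: "hom (a * b) = hom a * hom b"
    and hom_one: "hom 1 = 1"
begin

lemma hom_zero: "hom 0 = 0"
  using hom_add[of 0 0] by simp

lemma hom_uminus: "hom (- a) = - hom a"
  using hom_add[of a "- a"] by (simp add: hom_zero minus_unique)

lemma hom_diff: "hom (a - b) = hom a - hom b"
  using hom_add[of a "- b"] by (simp add: hom_uminus)

lemma hom_sum: "hom (sum f A) = (\<Sum>x\<in>A. hom (f x))"
  using sum_comp_morphism[of hom f A] by (simp add: hom_zero hom_add o_def)

lemma map_matrix_mult: "map_matrix hom (A ** B) = map_matrix hom A ** map_matrix hom B"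
  by (simp add: vec_eq_iff matrix_matrix_mult_def hom_sum hom_mult)

lemma map_matrix_one: "map_matrix hom (mat 1) = mat 1"
  by (simp add: vec_eq_iff mat_def hom_zero hom_one)

lemma map_matrix_diff: "map_matrix hom (A - B) = map_matrix hom A - map_matrix hom B"
  by (simp add: vec_eq_iff hom_diff)

end

definition fps_map :: "('a \<Rightarrow> 'b) \<Rightarrow> 'a fps \<Rightarrow> 'b fps" where
  "fps_map h f = Abs_fps (\<lambda>i. h (fps_nth f i))"

lemma fps_map_nth [simp]: "fps_nth (fps_map h f) i = h (fps_nth f i)"
  by (simp add: fps_map_def)

lemma (in comm_ring_hom) comm_ring_hom_fps_map: "comm_ring_hom (fps_map hom)"
  by unfold_locales (simp_all add: fps_ext hom_add hom_mult hom_one hom_zero hom_sum fps_mult_nth)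

lemma comm_ring_hom_fps_constant_term: "comm_ring_hom (\<lambda>f::'a::comm_ring_1 fps. fps_nth f 0)"
  by unfold_locales simp_all

lemma GL2_mult [simp]: "x \<otimes>\<^bsub>GL2\<^esub> y = x ** y"
  by (simp add: GL2_def)

lemma GL2_one [simp]: "\<one>\<^bsub>GL2\<^esub> = mat 1"
  by (simp add: GL2_def)

lemma group_GL2: "group (GL2 :: ('a::comm_ring_1^2^2) monoid)"
proof (rule groupI)
  fix A B :: "'a^2^2"
  assume "A \<in> carrier GL2" "B \<in> carrier GL2"
  then obtain A' B' where "A ** A' = mat 1" "A' ** A = mat 1" "B ** B' = mat 1" "B' ** B = mat 1"
    by (auto simp: GL2_def)
  then have "(A ** B) ** (B' ** A') = mat 1" "(B' ** A') ** (A ** B) = mat 1"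
    by (metis matrix_mul_assoc matrix_mul_lid)+
  then show "A \<otimes>\<^bsub>GL2\<^esub> B \<in> carrier GL2"
    by (auto simp: GL2_def)
next
  fix A :: "'a^2^2"
  assume "A \<in> carrier GL2"
  then obtain A' where "A ** A' = mat 1" "A' ** A = mat 1"
    by (auto simp: GL2_def)
  then show "\<exists>B\<in>carrier GL2. B \<otimes>\<^bsub>GL2\<^esub> A = \<one>\<^bsub>GL2\<^esub>"
    by (auto simp: GL2_def)
qed (auto simp: GL2_def matrix_mul_assoc intro!: exI[of _ "mat 1"])

lemma GL2_inverse:
  assumes "A \<in> carrier GL2"
  shows "A ** inv\<^bsub>GL2\<^esub> A = mat 1" "inv\<^bsub>GL2\<^esub> A ** A = mat 1"
  using group.r_inv[OF group_GL2 assms] group.l_inv[OF group_GL2 assms] by simp_all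

lemma commutator_in_GL2:
  "A \<in> carrier GL2 \<Longrightarrow> B \<in> carrier GL2 \<Longrightarrow> A ** B ** inv\<^bsub>GL2\<^esub> A ** inv\<^bsub>GL2\<^esub> B \<in> carrier GL2"
  using group.inv_closed[OF group_GL2] monoid.m_closed[OF group.is_monoid[OF group_GL2]]
  by (metis GL2_mult)

lemma GL2_subgroupI:
  assumes "P (mat 1)"
    and "\<And>A B. A \<in> carrier GL2 \<Longrightarrow> B \<in> carrier GL2 \<Longrightarrow> P A \<Longrightarrow> P B \<Longrightarrow> P (A ** B)"
    and "\<And>A. A \<in> carrier GL2 \<Longrightarrow> P A \<Longrightarrow> P (inv\<^bsub>GL2\<^esub> A)"
  shows "subgroup {A \<in> carrier GL2. P A} (GL2 :: ('a::comm_ring_1^2^2) monoid)"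
proof (rule group.subgroupI[OF group_GL2])
  have "mat 1 \<in> carrier (GL2 :: ('a^2^2) monoid)"
    by (auto simp: GL2_def intro!: exI[of _ "mat 1"])
  then show "{A \<in> carrier GL2. P A} \<noteq> {}"
    using assms(1) by blast
next
  fix A assume "A \<in> {A \<in> carrier GL2. P A}"
  then show "inv\<^bsub>GL2\<^esub> A \<in> {A \<in> carrier GL2. P A}"
    using assms(3) group.inv_closed[OF group_GL2] by blast
next
  fix A B assume "A \<in> {A \<in> carrier GL2. P A}" "B \<in> {A \<in> carrier GL2. P A}"
  then show "A \<otimes>\<^bsub>GL2\<^esub> B \<in> {A \<in> carrier GL2. P A}"
    using assms(2) monoid.m_closed[OF group.is_monoid[OF group_GL2], of A B] by simp
qed auto

lemma (in comm_ring_hom) group_hom_GL2: "group_hom GL2 GL2 (map_matrix hom)"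
proof -
  have "map_matrix hom A \<in> carrier GL2" if "A \<in> carrier GL2" for A
  proof -
    from that obtain B where "A ** B = mat 1" "B ** A = mat 1"
      by (auto simp: GL2_def)
    then have "map_matrix hom A ** map_matrix hom B = mat 1" "map_matrix hom B ** map_matrix hom A = mat 1"
      by (metis map_matrix_mult map_matrix_one)+
    then show ?thesis
      by (auto simp: GL2_def)
  qed
  then show ?thesis
    by (auto simp: group_hom_def group_hom_axioms_def group_GL2 hom_def map_matrix_mult)
qed

lemma (in group) derived_subset_subgroup:
  assumes "subgroup K G"
    and "\<And>a b. a \<in> H \<Longrightarrow> b \<in> H \<Longrightarrow> a \<otimes> b \<otimes> inv a \<otimes> inv b \<in> K"
  shows "derived G H \<subseteq> K"
  unfolding derived_def by (rule generate_subgroup_incl) (use assms in auto)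

section \<open>The Laurent ring inside \<open>R[[s]]\<close>\<close>

lemma poly_mapping_sum_single:
  "p = (\<Sum>k\<in>Poly_Mapping.keys p. Poly_Mapping.single k (Poly_Mapping.lookup p k))"
  by (rule poly_mapping_eqI) (simp add: lookup_sum lookup_single when_def in_keys_iff)

lemma poly_mapping_mult_hom:
  fixes f :: "('a::comm_monoid_add \<Rightarrow>\<^sub>0 'b::comm_ring_1) \<Rightarrow> 'c::comm_ring_1"
  assumes add: "\<And>p q. f (p + q) = f p + f q"
    and single: "\<And>k l a b. f (Poly_Mapping.single k a * Poly_Mapping.single l b)
                   = f (Poly_Mapping.single k a) * f (Poly_Mapping.single l b)"
  shows "f (p * q) = f p * f q"
proof -
  have zero: "f 0 = 0"
    using add[of 0 0] by simp
  have f_sum: "f (sum g A) = (\<Sum>x\<in>A. f (g x))" for g :: "'d \<Rightarrow> 'a \<Rightarrow>\<^sub>0 'b" and A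
    using sum_comp_morphism[of f g A] by (simp add: zero add o_def)
  let ?m = "\<lambda>p k. Poly_Mapping.single k (Poly_Mapping.lookup p k)"
  have "f (p * q) = f ((\<Sum>k\<in>Poly_Mapping.keys p. ?m p k) * (\<Sum>l\<in>Poly_Mapping.keys q. ?m q l))"
    using poly_mapping_sum_single[of p] poly_mapping_sum_single[of q] by simp
  also have "\<dots> = (\<Sum>k\<in>Poly_Mapping.keys p. \<Sum>l\<in>Poly_Mapping.keys q. f (?m p k) * f (?m q l))"
    by (simp add: sum_product f_sum single)
  also have "\<dots> = f (\<Sum>k\<in>Poly_Mapping.keys p. ?m p k) * f (\<Sum>l\<in>Poly_Mapping.keys q. ?m q l)"
    by (simp add: sum_product f_sum)
  also have "\<dots> = f p * f q"
    using poly_mapping_sum_single[of p] poly_mapping_sum_single[of q] by simp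
  finally show ?thesis .
qed

lemma one_plus_X_mult_tinv_fps: "(1 + fps_X) * tinv_fps = 1"
proof (rule fps_ext)
  show "fps_nth ((1 + fps_X) * tinv_fps) n = fps_nth 1 n" for n
    by (cases n) (simp_all add: distrib_right tinv_fps_def)
qed

lemma tpow_fps_succ: "tpow_fps (n + 1) = (1 + fps_X) * tpow_fps n"
proof (cases "0 \<le> n")
  case True
  then show ?thesis
    by (simp add: tpow_fps_def nat_add_distrib)
next
  case False
  then obtain m where m: "nat (- n) = Suc m" "nat (- (n + 1)) = m"
    by (intro that[of "nat (- n) - 1"]) auto
  then show ?thesis
    using False one_plus_X_mult_tinv_fps
    by (auto simp: tpow_fps_def mult.assoc[symmetric])
qed

lemma tpow_fps_pred: "tpow_fps (n - 1) = tinv_fps * tpow_fps n"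
proof (cases "0 < n")
  case True
  then obtain m where m: "nat n = Suc m" "nat (n - 1) = m"
    by (intro that[of "nat n - 1"]) auto
  then show ?thesis
    using True one_plus_X_mult_tinv_fps
    by (auto simp: tpow_fps_def mult.assoc[symmetric] mult.commute)
next
  case False
  then have "nat (1 - n) = Suc (nat (- n))"
    by simp
  then show ?thesis
    using False by (simp add: tpow_fps_def)
qed

lemma tpow_fps_add: "tpow_fps (m + n) = tpow_fps m * tpow_fps n"
proof (induction m rule: int_induct[where k = 0])
  case base
  then show ?case
    by (simp add: tpow_fps_def)
next
  case (step1 i)
  then show ?case
    using tpow_fps_succ[of "i + n"] tpow_fps_succ[of i] by (simp add: algebra_simps)
next
  case (step2 i)
  then show ?case
    using tpow_fps_pred[of "i + n"] tpow_fps_pred[of i] by (simp add: algebra_simps)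
qed

interpretation embed: comm_ring_hom embed_fps
proof
  show add: "embed_fps (p + q) = embed_fps p + embed_fps q" for p q
    unfolding embed_fps_def
    by (rule setsum_keys_plus_distrib) (simp_all add: distrib_right flip: fps_const_add)
  show "embed_fps (p * q) = embed_fps p * embed_fps q" for p q
    by (rule poly_mapping_mult_hom[OF add]) (simp add: embed_fps_def mult_single tpow_fps_add mult_ac)
  show "embed_fps 1 = 1"
    by (simp add: embed_fps_def tpow_fps_def)
qed

interpretation aug: comm_ring_hom augR
proof
  show add: "augR (p + q) = augR p + augR q" for p q
    unfolding augR_def by (rule setsum_keys_plus_distrib) simp_all
  show "augR (p * q) = augR p * augR q" for p q
    by (rule poly_mapping_mult_hom[OF add]) (simp add: augR_def mult_single)
  show "augR 1 = 1"
    by (simp add: augR_def)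
qed

section \<open>Ideals and power series with coefficients in an ideal\<close>

definition is_ideal :: "'a::comm_ring_1 set \<Rightarrow> bool" where
  "is_ideal J \<longleftrightarrow> 0 \<in> J \<and> (\<forall>a\<in>J. \<forall>b\<in>J. a + b \<in> J) \<and> (\<forall>a\<in>J. \<forall>r. r * a \<in> J)"

lemma is_ideal_zero: "is_ideal J \<Longrightarrow> 0 \<in> J"
  by (simp add: is_ideal_def)

lemma is_ideal_add: "is_ideal J \<Longrightarrow> a \<in> J \<Longrightarrow> b \<in> J \<Longrightarrow> a + b \<in> J"
  by (simp add: is_ideal_def)

lemma is_ideal_mult_left: "is_ideal J \<Longrightarrow> a \<in> J \<Longrightarrow> r * a \<in> J"
  by (simp add: is_ideal_def)

lemma is_ideal_mult_right: "is_ideal J \<Longrightarrow> a \<in> J \<Longrightarrow> a * r \<in> J"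
  by (simp add: is_ideal_def mult.commute)

lemma is_ideal_uminus: "is_ideal J \<Longrightarrow> a \<in> J \<Longrightarrow> - a \<in> J"
  using is_ideal_mult_left[of J a "- 1"] by simp

lemma is_ideal_diff: "is_ideal J \<Longrightarrow> a \<in> J \<Longrightarrow> b \<in> J \<Longrightarrow> a - b \<in> J"
  using is_ideal_add[of J a "- b"] is_ideal_uminus[of J b] by simp

lemma is_ideal_sum: "is_ideal J \<Longrightarrow> (\<And>i. i \<in> S \<Longrightarrow> f i \<in> J) \<Longrightarrow> sum f S \<in> J"
  by (induction S rule: infinite_finite_induct) (auto simp: is_ideal_zero is_ideal_add)

lemma ideal_power_SucI:
  fixes m :: nat
  assumes "\<And>j. j < m \<Longrightarrow> a j \<in> ideal_power I n \<and> b j \<in> I"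
  shows "(\<Sum>j<m. a j * b j) \<in> ideal_power I (Suc n)"
  using assms by simp blast

lemma ideal_power_Suc_add:
  assumes "x \<in> ideal_power I (Suc n)" and "y \<in> ideal_power I (Suc n)"
  shows "x + y \<in> ideal_power I (Suc n)"
proof -
  obtain m :: nat and a b where y: "y = (\<Sum>j<m. a j * b j)"
    and ab: "\<forall>j<m. a j \<in> ideal_power I n \<and> b j \<in> I"
    using assms(2) by auto
  have "x + (\<Sum>j<k. a j * b j) \<in> ideal_power I (Suc n)" if "k \<le> m" for k
    using that
  proof (induction k)
    case 0
    then show ?case
      using assms(1) by simp
  next
    case (Suc k)
    then obtain m' :: nat and a' b' where
      IH: "x + (\<Sum>j<k. a j * b j) = (\<Sum>j<m'. a' j * b' j)" "\<forall>j<m'. a' j \<in> ideal_power I n \<and> b' j \<in> I"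
      by auto
    then have "x + (\<Sum>j<Suc k. a j * b j) = (\<Sum>j<Suc m'. (a'(m' := a k)) j * (b'(m' := b k)) j)"
      by (simp add: add.assoc[symmetric])
    moreover have "(\<Sum>j<Suc m'. (a'(m' := a k)) j * (b'(m' := b k)) j) \<in> ideal_power I (Suc n)"
      by (rule ideal_power_SucI) (use IH(2) ab Suc.prems in \<open>auto simp: less_Suc_eq\<close>)
    ultimately show ?case
      by (simp only:)
  qed
  then show ?thesis
    using y by blast
qed

lemma is_ideal_ideal_power: "is_ideal (ideal_power I n)"
proof (induction n)
  case 0
  then show ?case
    by (simp add: is_ideal_def)
next
  case (Suc n)
  have "r * x \<in> ideal_power I (Suc n)" if "x \<in> ideal_power I (Suc n)" for x r
  proof -
    from that obtain m :: nat and a b where "x = (\<Sum>j<m. a j * b j)" "\<forall>j<m. a j \<in> ideal_power I n \<and> b j \<in> I"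
      by auto
    then show ?thesis
      using is_ideal_mult_left[OF Suc.IH] ideal_power_SucI[of m "\<lambda>j. r * a j" I n b]
      by (simp add: sum_distrib_left mult.assoc)
  qed
  moreover have "0 \<in> ideal_power I (Suc n)"
    using ideal_power_SucI[of 0] by simp
  ultimately show ?case
    by (simp add: is_ideal_def ideal_power_Suc_add del: ideal_power.simps)
qed

lemma ideal_power_mult:
  "a \<in> ideal_power I m \<Longrightarrow> b \<in> ideal_power I n \<Longrightarrow> a * b \<in> ideal_power I (m + n)"
proof (induction n arbitrary: b)
  case 0
  then show ?case
    using is_ideal_mult_right[OF is_ideal_ideal_power] by simp
next
  case (Suc n)
  then obtain k :: nat and c d where "b = (\<Sum>j<k. c j * d j)" "\<forall>j<k. c j \<in> ideal_power I n \<and> d j \<in> I"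
    by auto
  then show ?case
    using Suc.IH[OF Suc.prems(1)] ideal_power_SucI[of k "\<lambda>j. a * c j" I "m + n" d]
    by (simp add: sum_distrib_left mult.assoc)
qed

lemma ideal_power_one: "a \<in> I \<Longrightarrow> a \<in> ideal_power I 1"
  using ideal_power_SucI[of 1 "\<lambda>_. 1" I 0 "\<lambda>_. a"] by simp

definition fps_ideal :: "'a::comm_ring_1 set \<Rightarrow> nat \<Rightarrow> 'a fps set" where
  "fps_ideal J d = {f. \<forall>i. fps_nth f i \<in> J \<and> (i < d \<longrightarrow> fps_nth f i = 0)}"

lemma fps_ideal_mult:
  assumes K: "is_ideal K" and JJ'K: "\<And>a b. a \<in> J \<Longrightarrow> b \<in> J' \<Longrightarrow> a * b \<in> K"
    and f: "f \<in> fps_ideal J d" and g: "g \<in> fps_ideal J' e"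
  shows "f * g \<in> fps_ideal K (d + e)"
proof -
  have "fps_nth (f * g) n \<in> K" for n
    unfolding fps_mult_nth using f g by (auto simp: fps_ideal_def intro!: is_ideal_sum[OF K] JJ'K)
  moreover have "fps_nth (f * g) n = 0" if "n < d + e" for n
    unfolding fps_mult_nth
  proof (intro sum.neutral ballI)
    fix i assume "i \<in> {0..n}"
    then have "i < d \<or> n - i < e"
      using that by auto
    then show "fps_nth f i * fps_nth g (n - i) = 0"
      using f g by (auto simp: fps_ideal_def)
  qed
  ultimately show ?thesis
    by (simp add: fps_ideal_def)
qed

lemma is_ideal_fps_ideal:
  assumes "is_ideal J"
  shows "is_ideal (fps_ideal J d)"
proof -
  have "r * f \<in> fps_ideal J d" if "f \<in> fps_ideal J d" for r f
    using fps_ideal_mult[OF assms, of UNIV J r 0 f d] that is_ideal_mult_left[OF assms]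
    by (simp add: fps_ideal_def)
  then show ?thesis
    using assms by (auto simp: is_ideal_def fps_ideal_def)
qed

lemma fps_ideal_SucI: "f \<in> fps_ideal J d \<Longrightarrow> fps_nth f d = 0 \<Longrightarrow> f \<in> fps_ideal J (Suc d)"
  by (auto simp: fps_ideal_def less_Suc_eq)

section \<open>Congruence subgroups and commutators\<close>

definition entries_in :: "'a set \<Rightarrow> ('a^'n^'m) set" where
  "entries_in J = {A. \<forall>i j. A $ i $ j \<in> J}"

lemma entries_in_mult:
  assumes "is_ideal K" and "\<And>a b. a \<in> J \<Longrightarrow> b \<in> J' \<Longrightarrow> a * b \<in> K"
    and "A \<in> entries_in J" and "B \<in> entries_in J'"
  shows "A ** B \<in> entries_in K"
  using assms by (auto simp: entries_in_def matrix_matrix_mult_def intro!: is_ideal_sum)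

lemma entries_in_mult_right: "is_ideal J \<Longrightarrow> A \<in> entries_in J \<Longrightarrow> A ** B \<in> entries_in J"
  by (rule entries_in_mult[of J J UNIV]) (auto simp: is_ideal_mult_right entries_in_def)

lemma entries_in_add: "is_ideal J \<Longrightarrow> A \<in> entries_in J \<Longrightarrow> B \<in> entries_in J \<Longrightarrow> A + B \<in> entries_in J"
  by (simp add: entries_in_def is_ideal_add)

lemma entries_in_diff: "is_ideal J \<Longrightarrow> A \<in> entries_in J \<Longrightarrow> B \<in> entries_in J \<Longrightarrow> A - B \<in> entries_in J"
  by (simp add: entries_in_def is_ideal_diff)

lemma entries_in_uminus: "is_ideal J \<Longrightarrow> A \<in> entries_in J \<Longrightarrow> - A \<in> entries_in J"
  by (simp add: entries_in_def is_ideal_uminus)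

lemma matrix_add_rdistrib: "(A + B) ** C = A ** C + B ** (C :: 'a::comm_ring_1^'n^'n)"
  by (simp add: vec_eq_iff matrix_matrix_mult_def sum.distrib algebra_simps)

lemma matrix_diff_rdistrib: "(A - B) ** C = A ** C - B ** (C :: 'a::comm_ring_1^'n^'n)"
  by (simp add: vec_eq_iff matrix_matrix_mult_def sum_subtractf algebra_simps)

lemma matrix_diff_ldistrib: "C ** (A - B) = C ** A - C ** (B :: 'a::comm_ring_1^'n^'n)"
  by (simp add: vec_eq_iff matrix_matrix_mult_def sum_subtractf algebra_simps)

lemma commutator_minus_one:
  fixes A B A' B' :: "'a::comm_ring_1^'n^'n"
  assumes "A ** A' = mat 1" and "B ** B' = mat 1"
  shows "A ** B ** A' ** B' - mat 1
    = ((A - mat 1) ** (B - mat 1) - (B - mat 1) ** (A - mat 1)) ** (A' ** B')"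
proof -
  have "B ** A ** (A' ** B') = mat 1"
    by (metis assms matrix_mul_assoc matrix_mul_rid)
  then have "A ** B ** A' ** B' - mat 1 = (A ** B - B ** A) ** (A' ** B')"
    by (simp add: matrix_diff_rdistrib matrix_mul_assoc)
  also have "A ** B - B ** A = (A - mat 1) ** (B - mat 1) - (B - mat 1) ** (A - mat 1)"
    by (simp add: matrix_diff_rdistrib matrix_diff_ldistrib)
  finally show ?thesis .
qed

definition congruence_subgroup :: "'a::comm_ring_1 set \<Rightarrow> ('a^2^2) set" where
  "congruence_subgroup J = {A \<in> carrier GL2. A - mat 1 \<in> entries_in J}"

lemma subgroup_congruence_subgroup:
  assumes J: "is_ideal J"
  shows "subgroup (congruence_subgroup J) GL2"
  unfolding congruence_subgroup_def
proof (rule GL2_subgroupI)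
  show "mat 1 - mat 1 \<in> entries_in J"
    using J by (simp add: entries_in_def is_ideal_zero)
next
  fix A B :: "'a^2^2"
  assume "A - mat 1 \<in> entries_in J" "B - mat 1 \<in> entries_in J"
  have "A ** B - mat 1 = (A - mat 1) ** B + (B - mat 1)"
    by (simp add: matrix_diff_rdistrib)
  also have "\<dots> \<in> entries_in J"
    using J \<open>A - mat 1 \<in> entries_in J\<close> \<open>B - mat 1 \<in> entries_in J\<close>
    by (intro entries_in_add entries_in_mult_right)
  finally show "A ** B - mat 1 \<in> entries_in J" .
next
  fix A :: "'a^2^2"
  assume "A \<in> carrier GL2" "A - mat 1 \<in> entries_in J"
  have "inv\<^bsub>GL2\<^esub> A - mat 1 = - ((A - mat 1) ** inv\<^bsub>GL2\<^esub> A)"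
    using GL2_inverse[OF \<open>A \<in> carrier GL2\<close>] by (simp add: matrix_diff_rdistrib)
  also have "\<dots> \<in> entries_in J"
    using J \<open>A - mat 1 \<in> entries_in J\<close> by (intro entries_in_uminus entries_in_mult_right)
  finally show "inv\<^bsub>GL2\<^esub> A - mat 1 \<in> entries_in J" .
qed

lemma congruence_subgroup_commutator:
  assumes K: "is_ideal K" and JJK: "\<And>a b. a \<in> J \<Longrightarrow> b \<in> J \<Longrightarrow> a * b \<in> K"
    and A: "A \<in> congruence_subgroup J" and B: "B \<in> congruence_subgroup J"
  shows "A ** B ** inv\<^bsub>GL2\<^esub> A ** inv\<^bsub>GL2\<^esub> B \<in> congruence_subgroup K"
proof -
  have GL: "A \<in> carrier GL2" "B \<in> carrier GL2"
    and AJ: "A - mat 1 \<in> entries_in J" and BJ: "B - mat 1 \<in> entries_in J"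
    using A B by (auto simp: congruence_subgroup_def)
  have "(A - mat 1) ** (B - mat 1) - (B - mat 1) ** (A - mat 1) \<in> entries_in K"
    using entries_in_mult[OF K JJK] AJ BJ by (intro entries_in_diff[OF K])
  then show ?thesis
    using K GL commutator_in_GL2[OF GL]
    by (simp add: congruence_subgroup_def commutator_minus_one GL2_inverse entries_in_mult_right)
qed

section \<open>Rank-one updates and lower column-stochastic matrices\<close>

definition vec_dot :: "'a::comm_ring_1^'n \<Rightarrow> 'a^'n \<Rightarrow> 'a" where
  "vec_dot r u = (\<Sum>i\<in>UNIV. r $ i * u $ i)"

definition rank_one_update :: "'a::comm_ring_1^'n \<Rightarrow> 'a^'n \<Rightarrow> 'a^'n^'n" where
  "rank_one_update u r = mat 1 + (\<chi> i j. u $ i * r $ j)"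

lemma outer_mult_outer: "(\<chi> i j. u $ i * r $ j) ** (\<chi> i j. u $ i * q $ j) = (\<chi> i j. u $ i * (vec_dot r u *s q) $ j)"
  by (simp add: vec_eq_iff matrix_matrix_mult_def vec_dot_def sum_distrib_left sum_distrib_right algebra_simps)

lemma rank_one_update_zero: "rank_one_update u 0 = mat 1"
  by (simp add: rank_one_update_def vec_eq_iff)

lemma rank_one_update_mult:
  "rank_one_update u r ** rank_one_update u q = rank_one_update u (r + q + vec_dot r u *s q)"
proof -
  have "rank_one_update u r ** rank_one_update u q = mat 1 + (\<chi> i j. u $ i * q $ j) + (\<chi> i j. u $ i * r $ j) + (\<chi> i j. u $ i * r $ j) ** (\<chi> i j. u $ i * q $ j)"
    by (simp add: rank_one_update_def matrix_add_ldistrib matrix_add_rdistrib)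
  also have "... = rank_one_update u (r + q + vec_dot r u *s q)"
    by (simp only: outer_mult_outer) (simp add: rank_one_update_def vec_eq_iff algebra_simps)
  finally show ?thesis .
qed

lemma rank_one_update_right_inverse:
  assumes "rank_one_update u r ** B = mat 1"
  shows "B = rank_one_update u (- (r v* B))"
proof -
  have "(\<chi> i j. u $ i * r $ j) ** B = (\<chi> i j. u $ i * (r v* B) $ j)"
    by (simp add: vec_eq_iff matrix_matrix_mult_def vector_matrix_mult_def sum_distrib_left mult.assoc)
  moreover have "B + (\<chi> i j. u $ i * r $ j) ** B = mat 1"
    using assms by (simp add: rank_one_update_def matrix_add_rdistrib)
  ultimately show ?thesis
    by (simp add: rank_one_update_def vec_eq_iff algebra_simps)
qed

lemma rank_one_update_minus_one_mult_eq_0: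
  assumes "vec_dot r u = 0"
  shows "(rank_one_update u r - mat 1) ** (rank_one_update u q - mat 1) = 0"
  using assms by (simp add: rank_one_update_def outer_mult_outer vec_eq_iff)

lemma det_rank_one_update: "det (rank_one_update u r :: 'a::comm_ring_1^2^2) = 1 + vec_dot r u"
  by (simp add: det_2 rank_one_update_def vec_dot_def mat_def sum_2 algebra_simps)

lemma mat2_nth [simp]:
  "mat2 a b c d $ 1 $ 1 = a" "mat2 a b c d $ 1 $ 2 = b"
  "mat2 a b c d $ 2 $ 1 = c" "mat2 a b c d $ 2 $ 2 = d"
  by (simp_all add: mat2_def)

lemma mat2_eqI: "A $ 1 $ 1 = a \<Longrightarrow> A $ 1 $ 2 = b \<Longrightarrow> A $ 2 $ 1 = c \<Longrightarrow> A $ 2 $ 2 = d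
  \<Longrightarrow> A = mat2 a b c d"
  unfolding vec_eq_iff forall_2 by simp

lemma mat2_eta: "A = mat2 (A $ 1 $ 1) (A $ 1 $ 2) (A $ 2 $ 1) (A $ 2 $ 2)"
  by (rule mat2_eqI) simp_all

lemma mat2_eq_iff: "mat2 a b c d = mat2 a' b' c' d' \<longleftrightarrow> a = a' \<and> b = b' \<and> c = c' \<and> d = d'"
  by (metis mat2_nth)

lemma mat2_mult:
  "mat2 a b c d ** mat2 a' b' c' d' = mat2 (a*a'+b*c') (a*b'+b*d') (c*a'+d*c') (c*b'+d*d')"
  by (rule mat2_eqI) (simp_all add: matrix_matrix_mult_def sum_2)

lemma mat2_one: "(mat 1 :: 'a::comm_ring_1^2^2) = mat2 1 0 0 1"
  by (rule mat2_eqI) (simp_all add: mat_def)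

lemma map_matrix_mat2: "map_matrix f (mat2 a b c d) = mat2 (f a) (f b) (f c) (f d)"
  by (rule mat2_eqI) simp_all

lemma triangular_mat2_in_GL2:
  fixes a d :: "'a::comm_ring_1"
  assumes "a * a' = 1" and "d * d' = 1"
  shows "mat2 a b 0 d \<in> carrier GL2" and "mat2 a 0 c d \<in> carrier GL2"
proof -
  have cancel: "a * (a' * x) = x" "d * (d' * x) = x" "a' * (a * x) = x" "d' * (d * x) = x" for x
    using assms by (metis mult.assoc mult.commute mult_1)+
  have "mat2 a b 0 d ** mat2 a' (- (a' * b * d')) 0 d' = mat 1"
    "mat2 a' (- (a' * b * d')) 0 d' ** mat2 a b 0 d = mat 1"
    "mat2 a 0 c d ** mat2 a' 0 (- (d' * c * a')) d' = mat 1"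
    "mat2 a' 0 (- (d' * c * a')) d' ** mat2 a 0 c d = mat 1"
    using assms by (simp_all add: mat2_mult mat2_one mat2_eq_iff mult_ac cancel)
  then show "mat2 a b 0 d \<in> carrier GL2" "mat2 a 0 c d \<in> carrier GL2"
    by (auto simp: GL2_def)
qed

lemma rank_one_update_mat2:
  "rank_one_update u r = mat2 (1 + u $ 1 * r $ 1) (u $ 1 * r $ 2) (u $ 2 * r $ 1) (1 + u $ 2 * r $ 2)"
  by (rule mat2_eqI) (simp_all add: rank_one_update_def mat_def)

definition lower_stochastic :: "'a::comm_ring_1 \<Rightarrow> 'a^2^2" where
  "lower_stochastic c = mat2 c 0 (1 - c) 1"

lemma lower_stochastic_one: "lower_stochastic 1 = mat 1"
  by (simp add: lower_stochastic_def mat2_one)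

lemma lower_stochastic_mult: "lower_stochastic c ** lower_stochastic c' = lower_stochastic (c * c')"
  by (simp add: lower_stochastic_def mat2_mult mat2_eq_iff algebra_simps)

lemma lower_stochastic_inverse:
  assumes "lower_stochastic c ** B = mat 1" and "B ** lower_stochastic c = mat 1"
  shows "B = lower_stochastic (B $ 1 $ 1)"
proof -
  obtain b11 b12 b21 b22 where B: "B = mat2 b11 b12 b21 b22"
    using mat2_eta by blast
  from assms have "c * b11 = 1" "(1 - c) * b11 + b21 = 0" "(1 - c) * b12 + b22 = 1" "b12 = 0"
    by (simp_all add: B lower_stochastic_def mat2_mult mat2_one mat2_eq_iff)
  moreover have "b21 - (1 - b11) = ((1 - c) * b11 + b21) + (c * b11 - 1)"
    by (simp add: algebra_simps)
  ultimately show ?thesis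
    by (simp add: B lower_stochastic_def mat2_eq_iff)
qed

section \<open>The group \<open>F\<close> and its derived series\<close>

abbreviation embed_mat :: "RT^2^2 \<Rightarrow> R fps^2^2" where
  "embed_mat \<equiv> map_matrix embed_fps"

text \<open>Since \<open>s = t - 1\<close>, evaluation at \<open>t = 1\<close> takes constant coefficients.\<close>
abbreviation at_t1 :: "R fps^2^2 \<Rightarrow> R^2^2" where
  "at_t1 \<equiv> map_matrix (\<lambda>f. fps_nth f 0)"

abbreviation aug_mat :: "R fps^2^2 \<Rightarrow> int fps^2^2" where
  "aug_mat \<equiv> map_matrix (fps_map augR)"

interpretation at_t1: comm_ring_hom "\<lambda>f::R fps. fps_nth f 0"
  by (rule comm_ring_hom_fps_constant_term)

interpretation aug_fps: comm_ring_hom "fps_map augR"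
  by (rule aug.comm_ring_hom_fps_map)

lemma entries_in_Sigma_if_aug_mat_eq_one:
  assumes "aug_mat A = mat 1"
  shows "A - mat 1 \<in> entries_in (fps_ideal Sigma_ideal 0)"
proof -
  have "aug_mat (A - mat 1) = 0"
    using assms by (simp add: aug_fps.map_matrix_diff aug_fps.map_matrix_one)
  then show ?thesis
    by (auto simp: entries_in_def fps_ideal_def Sigma_ideal_def vec_eq_iff fps_eq_iff)
qed

text \<open>At \<open>t = 1\<close>: \<open>M1 = I + u (0, 1)\<^sup>T\<close> and \<open>M2T = I + u (-1, 0)\<^sup>T\<close> for this \<open>u\<close>.\<close>
definition uR :: "R^2" where
  "uR = (\<chi> i. if i = 1 then 1 - yR else xR - 1)"

definition level0 :: "(R fps^2^2) set" where
  "level0 = {A \<in> carrier GL2.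
     (\<exists>r. at_t1 A = rank_one_update uR r) \<and> (\<exists>c. aug_mat A = lower_stochastic c)}"

definition level1 :: "(R fps^2^2) set" where
  "level1 = {A \<in> carrier GL2.
     (\<exists>r. at_t1 A = rank_one_update uR r) \<and> det (at_t1 A) = 1 \<and> aug_mat A = mat 1}"

lemma subgroup_level0: "subgroup level0 GL2"
  unfolding level0_def
proof (rule GL2_subgroupI)
  show "(\<exists>r. at_t1 (mat 1) = rank_one_update uR r) \<and> (\<exists>c. aug_mat (mat 1) = lower_stochastic c)"
    by (metis at_t1.map_matrix_one aug_fps.map_matrix_one rank_one_update_zero lower_stochastic_one)
next
  fix A B :: "R fps^2^2"
  assume "(\<exists>r. at_t1 A = rank_one_update uR r) \<and> (\<exists>c. aug_mat A = lower_stochastic c)"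
    and "(\<exists>r. at_t1 B = rank_one_update uR r) \<and> (\<exists>c. aug_mat B = lower_stochastic c)"
  then show "(\<exists>r. at_t1 (A ** B) = rank_one_update uR r) \<and> (\<exists>c. aug_mat (A ** B) = lower_stochastic c)"
    by (auto simp: at_t1.map_matrix_mult aug_fps.map_matrix_mult rank_one_update_mult lower_stochastic_mult)
next
  fix A :: "R fps^2^2"
  assume A: "A \<in> carrier GL2"
    and "(\<exists>r. at_t1 A = rank_one_update uR r) \<and> (\<exists>c. aug_mat A = lower_stochastic c)"
  then obtain r c where r: "at_t1 A = rank_one_update uR r" and c: "aug_mat A = lower_stochastic c"
    by blast
  have "rank_one_update uR r ** at_t1 (inv\<^bsub>GL2\<^esub> A) = mat 1"
    by (metis r GL2_inverse(1)[OF A] at_t1.map_matrix_mult at_t1.map_matrix_one)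
  moreover have "lower_stochastic c ** aug_mat (inv\<^bsub>GL2\<^esub> A) = mat 1"
    "aug_mat (inv\<^bsub>GL2\<^esub> A) ** lower_stochastic c = mat 1"
    by (metis c GL2_inverse[OF A] aug_fps.map_matrix_mult aug_fps.map_matrix_one)+
  ultimately show "(\<exists>r. at_t1 (inv\<^bsub>GL2\<^esub> A) = rank_one_update uR r)
      \<and> (\<exists>c. aug_mat (inv\<^bsub>GL2\<^esub> A) = lower_stochastic c)"
    using rank_one_update_right_inverse lower_stochastic_inverse by blast
qed

lemma subgroup_level1: "subgroup level1 GL2"
  unfolding level1_def
proof (rule GL2_subgroupI)
  show "(\<exists>r. at_t1 (mat 1) = rank_one_update uR r) \<and> det (at_t1 (mat 1)) = 1 \<and> aug_mat (mat 1) = mat 1"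
    by (metis at_t1.map_matrix_one aug_fps.map_matrix_one rank_one_update_zero det_I)
next
  fix A B :: "R fps^2^2"
  assume "(\<exists>r. at_t1 A = rank_one_update uR r) \<and> det (at_t1 A) = 1 \<and> aug_mat A = mat 1"
    and "(\<exists>r. at_t1 B = rank_one_update uR r) \<and> det (at_t1 B) = 1 \<and> aug_mat B = mat 1"
  then show "(\<exists>r. at_t1 (A ** B) = rank_one_update uR r) \<and> det (at_t1 (A ** B)) = 1 \<and> aug_mat (A ** B) = mat 1"
    by (auto simp: at_t1.map_matrix_mult aug_fps.map_matrix_mult rank_one_update_mult det_mul)
next
  fix A :: "R fps^2^2"
  assume A: "A \<in> carrier GL2"
    and "(\<exists>r. at_t1 A = rank_one_update uR r) \<and> det (at_t1 A) = 1 \<and> aug_mat A = mat 1"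
  then obtain r where r: "at_t1 A = rank_one_update uR r"
    and det: "det (at_t1 A) = 1" and aug: "aug_mat A = mat 1"
    by blast
  have inv: "at_t1 A ** at_t1 (inv\<^bsub>GL2\<^esub> A) = mat 1" "aug_mat A ** aug_mat (inv\<^bsub>GL2\<^esub> A) = mat 1"
    using GL2_inverse(1)[OF A]
    by (simp_all flip: at_t1.map_matrix_mult at_t1.map_matrix_one
        aug_fps.map_matrix_mult aug_fps.map_matrix_one)
  have "det (at_t1 A) * det (at_t1 (inv\<^bsub>GL2\<^esub> A)) = 1"
    by (simp only: inv(1) det_mul[symmetric] det_I)
  then show "(\<exists>r. at_t1 (inv\<^bsub>GL2\<^esub> A) = rank_one_update uR r)
      \<and> det (at_t1 (inv\<^bsub>GL2\<^esub> A)) = 1 \<and> aug_mat (inv\<^bsub>GL2\<^esub> A) = mat 1"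
    using rank_one_update_right_inverse inv r det aug by auto
qed

lemma level0_commutator:
  assumes A: "A \<in> level0" and B: "B \<in> level0"
  shows "A ** B ** inv\<^bsub>GL2\<^esub> A ** inv\<^bsub>GL2\<^esub> B \<in> level1"
proof -
  let ?A' = "inv\<^bsub>GL2\<^esub> A" and ?B' = "inv\<^bsub>GL2\<^esub> B"
  have A': "?A' \<in> level0" and B': "?B' \<in> level0"
    using A B subgroup.m_inv_closed[OF subgroup_level0] by simp_all
  have GL: "A \<in> carrier GL2" "B \<in> carrier GL2"
    using A B by (simp_all add: level0_def)
  obtain a b a' b' where
    "at_t1 A = rank_one_update uR a" "at_t1 B = rank_one_update uR b"
    "at_t1 ?A' = rank_one_update uR a'" "at_t1 ?B' = rank_one_update uR b'"
    using A B A' B' by (auto simp: level0_def)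
  then have rank_one: "\<exists>r. at_t1 (A ** B ** ?A' ** ?B') = rank_one_update uR r"
    by (simp add: at_t1.map_matrix_mult rank_one_update_mult) blast
  have "det (at_t1 (A ** B ** ?A' ** ?B')) = det (at_t1 (A ** ?A')) * det (at_t1 (B ** ?B'))"
    by (simp add: at_t1.map_matrix_mult det_mul)
  then have det: "det (at_t1 (A ** B ** ?A' ** ?B')) = 1"
    by (simp add: GL2_inverse GL at_t1.map_matrix_one)
  obtain c d c' d' where
    "aug_mat A = lower_stochastic c" "aug_mat B = lower_stochastic d"
    "aug_mat ?A' = lower_stochastic c'" "aug_mat ?B' = lower_stochastic d'"
    using A B A' B' by (auto simp: level0_def)
  \<comment> \<open>lower column-stochastic matrices commute\<close>
  then have "aug_mat (A ** B ** ?A' ** ?B') = aug_mat (A ** ?A') ** aug_mat (B ** ?B')"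
    by (simp add: aug_fps.map_matrix_mult lower_stochastic_mult mult_ac)
  then have aug: "aug_mat (A ** B ** ?A' ** ?B') = mat 1"
    by (simp add: GL2_inverse GL aug_fps.map_matrix_one)
  show ?thesis
    using commutator_in_GL2[OF GL] rank_one det aug by (simp add: level1_def)
qed

definition filtration :: "nat \<Rightarrow> R fps set" where
  "filtration d = fps_ideal (ideal_power Sigma_ideal (2 * d)) d"

lemma is_ideal_filtration: "is_ideal (filtration d)"
  by (simp add: filtration_def is_ideal_fps_ideal is_ideal_ideal_power)

lemma filtration_mult: "f \<in> filtration d \<Longrightarrow> g \<in> filtration d \<Longrightarrow> f * g \<in> filtration (2 * d)"
  unfolding filtration_def mult_2
  by (rule fps_ideal_mult[OF is_ideal_ideal_power]) (simp_all add: ideal_power_mult)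

lemma level1_commutator:
  assumes A: "A \<in> level1" and B: "B \<in> level1"
  shows "A ** B ** inv\<^bsub>GL2\<^esub> A ** inv\<^bsub>GL2\<^esub> B \<in> congruence_subgroup (filtration 1)"
proof -
  let ?D = "(A - mat 1) ** (B - mat 1) - (B - mat 1) ** (A - mat 1)"
  have GL: "A \<in> carrier GL2" "B \<in> carrier GL2"
    using A B by (simp_all add: level1_def)
  have Sigma2: "a * b \<in> ideal_power Sigma_ideal 2" if "a \<in> Sigma_ideal" "b \<in> Sigma_ideal" for a b
    using ideal_power_mult[OF ideal_power_one ideal_power_one, OF that] by (simp only: one_add_one)
  have fps_Sigma2: "f * g \<in> fps_ideal (ideal_power Sigma_ideal 2) 0"
    if "f \<in> fps_ideal Sigma_ideal 0" "g \<in> fps_ideal Sigma_ideal 0" for f g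
    using fps_ideal_mult[OF is_ideal_ideal_power Sigma2 that] by simp
  have "A - mat 1 \<in> entries_in (fps_ideal Sigma_ideal 0)" "B - mat 1 \<in> entries_in (fps_ideal Sigma_ideal 0)"
    using A B by (simp_all add: level1_def entries_in_Sigma_if_aug_mat_eq_one)
  then have D: "?D \<in> entries_in (fps_ideal (ideal_power Sigma_ideal 2) 0)"
    using entries_in_mult[OF is_ideal_fps_ideal[OF is_ideal_ideal_power] fps_Sigma2]
    by (intro entries_in_diff[OF is_ideal_fps_ideal[OF is_ideal_ideal_power]])
  obtain a b where "at_t1 A = rank_one_update uR a" "at_t1 B = rank_one_update uR b"
    and "det (at_t1 A) = 1" "det (at_t1 B) = 1"
    using A B by (auto simp: level1_def)
  \<comment> \<open>\<open>det (I + u r\<^sup>T) = 1 + r\<^sup>T u\<close>, so \<open>r\<^sup>T u = 0\<close> and \<open>(u r\<^sup>T)(u q\<^sup>T) = 0\<close>\<close>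
  then have "at_t1 ?D = 0"
    by (simp add: at_t1.map_matrix_mult at_t1.map_matrix_diff at_t1.map_matrix_one
        det_rank_one_update rank_one_update_minus_one_mult_eq_0)
  then have "?D \<in> entries_in (filtration 1)"
    using D by (auto simp: entries_in_def filtration_def vec_eq_iff intro: fps_ideal_SucI)
  then show ?thesis
    using commutator_in_GL2[OF GL] is_ideal_filtration
    by (simp add: congruence_subgroup_def commutator_minus_one GL2_inverse GL entries_in_mult_right)
qed

lemma derived_level0: "derived GL2 level0 \<subseteq> level1"
  by (rule group.derived_subset_subgroup[OF group_GL2 subgroup_level1]) (simp add: level0_commutator)

lemma derived_level1: "derived GL2 level1 \<subseteq> congruence_subgroup (filtration 1)"
  by (rule group.derived_subset_subgroup[OF group_GL2 subgroup_congruence_subgroup[OF is_ideal_filtration]])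
    (simp only: GL2_mult level1_commutator)

lemma derived_congruence_filtration:
  "derived GL2 (congruence_subgroup (filtration d)) \<subseteq> congruence_subgroup (filtration (2 * d))"
  by (rule group.derived_subset_subgroup[OF group_GL2 subgroup_congruence_subgroup[OF is_ideal_filtration]])
    (simp add: congruence_subgroup_commutator[OF is_ideal_filtration filtration_mult])

lemma iterated_derived_level0:
  assumes "2 \<le> k"
  shows "(derived GL2 ^^ k) level0 \<subseteq> congruence_subgroup (filtration (2 ^ (k - 2)))"
  using assms
proof (induction k rule: dec_induct)
  case base
  show ?case
    using group.mono_derived[OF group_GL2 derived_level0] derived_level1
    by (simp add: numeral_2_eq_2)
next
  case (step k)
  have "Suc k - 2 = Suc (k - 2)"
    using step.hyps(1) by simp
  then have "2 * 2 ^ (k - 2) = (2::nat) ^ (Suc k - 2)"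
    by simp
  then show ?case
    using group.mono_derived[OF group_GL2 step.IH] derived_congruence_filtration[of "2 ^ (k - 2)"]
    by simp
qed

lemma M1_in_GL2: "M1 \<in> carrier GL2"
proof -
  have "constT xR * constT (Poly_Mapping.single (-1, 0) 1) = 1"
    by (simp add: xR_def mult_single constT_def flip: zero_prod_def)
  then show ?thesis
    unfolding M1_def using triangular_mat2_in_GL2(1)[of 1 1] by simp
qed

lemma M2T_in_GL2: "M2T \<in> carrier GL2"
proof -
  have "(constT yR * tT) * (constT (Poly_Mapping.single (0, -1) 1) * Poly_Mapping.single (-1) 1) = 1"
    by (simp add: yR_def tT_def constT_def mult_single mult_ac flip: zero_prod_def)
  then show ?thesis
    unfolding M2T_def using triangular_mat2_in_GL2(2)[of _ _ 1 1] by simp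
qed

lemma embed_fps_constT: "embed_fps (constT r) = fps_const r"
  by (simp add: constT_def embed_fps_def tpow_fps_def)

lemma embed_fps_tT: "embed_fps tT = 1 + fps_X"
  by (simp add: tT_def embed_fps_def tpow_fps_def)

lemma fps_map_augR_fps_const: "fps_map augR (fps_const r) = fps_const (augR r)"
  by (rule fps_ext) (simp add: aug.hom_zero)

lemma fps_map_augR_fps_X: "fps_map augR fps_X = fps_X"
  by (rule fps_ext) (simp add: aug.hom_zero aug.hom_one)

lemma augR_xR: "augR xR = 1" and augR_yR: "augR yR = 1"
  by (simp_all add: augR_def xR_def yR_def)

lemma embed_mat_M1_in_level0: "embed_mat M1 \<in> level0"
proof -
  have "embed_mat M1 = mat2 1 (fps_const (1 - yR)) 0 (fps_const xR)"
    by (simp add: M1_def map_matrix_mat2 embed.hom_one embed.hom_zero embed_fps_constT)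
  moreover have "embed_mat M1 \<in> carrier GL2"
    using group_hom.hom_closed[OF embed.group_hom_GL2 M1_in_GL2] .
  moreover have "mat2 1 (1 - yR) 0 xR = rank_one_update uR (\<chi> i. if i = 1 then 0 else 1)"
    by (simp add: rank_one_update_mat2 uR_def)
  moreover have "mat2 1 0 0 1 = lower_stochastic (1 :: int fps)"
    by (simp add: lower_stochastic_def)
  ultimately show ?thesis
    unfolding level0_def
    by (auto simp: map_matrix_mat2 fps_map_augR_fps_const aug_fps.hom_one aug_fps.hom_zero
        aug.hom_diff aug.hom_one augR_xR augR_yR)
qed

lemma embed_mat_M2T_in_level0: "embed_mat M2T \<in> level0"
proof -
  have "embed_mat M2T = mat2 (fps_const yR * (1 + fps_X)) 0 (1 - fps_const xR * (1 + fps_X)) 1"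
    by (simp add: M2T_def map_matrix_mat2 embed.hom_one embed.hom_zero embed.hom_mult embed.hom_diff
        embed_fps_constT embed_fps_tT)
  moreover have "embed_mat M2T \<in> carrier GL2"
    using group_hom.hom_closed[OF embed.group_hom_GL2 M2T_in_GL2] .
  moreover have "mat2 yR 0 (1 - xR) 1 = rank_one_update uR (\<chi> i. if i = 1 then - 1 else 0)"
    by (simp add: rank_one_update_mat2 uR_def)
  moreover have "mat2 (1 + fps_X) 0 (1 - (1 + fps_X)) 1 = lower_stochastic (1 + fps_X :: int fps)"
    by (simp add: lower_stochastic_def)
  ultimately show ?thesis
    unfolding level0_def
    by (auto simp: map_matrix_mat2 fps_map_augR_fps_const fps_map_augR_fps_X aug_fps.hom_one
        aug_fps.hom_zero aug_fps.hom_mult aug_fps.hom_add aug_fps.hom_diff augR_xR augR_yR)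
qed

lemma embed_mat_image_Fderived:
  "embed_mat ` Fderived k = (derived GL2 ^^ k) (generate GL2 {embed_mat M1, embed_mat M2T})"
proof -
  interpret group_hom GL2 GL2 embed_mat
    by (rule embed.group_hom_GL2)
  have gens: "{M1, M2T} \<subseteq> carrier GL2"
    using M1_in_GL2 M2T_in_GL2 by simp
  then have "generate GL2 {embed_mat M1, embed_mat M2T} = embed_mat ` generate GL2 {M1, M2T}"
    using generate_img[OF gens] by simp
  then show ?thesis
    unfolding Fderived_def Fgrp_def using exp_of_derived_img[OF G.generate_incl[OF gens]] by simp
qed

lemma coefficients_of_congruence_subgroup:
  assumes "A \<in> congruence_subgroup (fps_ideal J d)" and "0 < d"
  shows "map_matrix (\<lambda>f. fps_nth f 0) A = mat 1"
    and "0 < i \<Longrightarrow> i < d \<Longrightarrow> map_matrix (\<lambda>f. fps_nth f i) A = 0"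
    and "d \<le> i \<Longrightarrow> map_matrix (\<lambda>f. fps_nth f i) A $ a $ b \<in> J"
proof -
  let ?E = "A - mat 1"
  have E: "fps_nth (?E $ a $ b) i \<in> J" "i < d \<Longrightarrow> fps_nth (?E $ a $ b) i = 0" for a b i
    using assms(1) by (simp_all add: congruence_subgroup_def entries_in_def fps_ideal_def)
  have low: "fps_nth (A $ a $ b) i = (if i = 0 \<and> a = b then 1 else 0)" if "i < d" for a b i
    using E(2)[OF that, of a b] by (cases "a = b") (auto simp: mat_def)
  have high: "fps_nth (A $ a $ b) i \<in> J" if "0 < i" for a b i
    using E(1)[of a b i] that by (cases "a = b") (auto simp: mat_def)
  show "map_matrix (\<lambda>f. fps_nth f 0) A = mat 1"
    using assms(2) by (simp add: vec_eq_iff low mat_def)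
  show "0 < i \<Longrightarrow> i < d \<Longrightarrow> map_matrix (\<lambda>f. fps_nth f i) A = 0"
    by (simp add: vec_eq_iff low)
  show "d \<le> i \<Longrightarrow> map_matrix (\<lambda>f. fps_nth f i) A $ a $ b \<in> J"
    using assms(2) high by simp
qed

theorem lemma7:
  fixes k :: nat and g :: "RT^2^2"
  assumes "k > 1"
    and "g \<in> Fderived k"
  shows "coeff_mat g 0 = mat 1
       \<and> (\<forall>i. 0 < i \<and> i < 2 ^ (k - 2) \<longrightarrow> coeff_mat g i = 0)
       \<and> (\<forall>i \<ge> 2 ^ (k - 2). \<forall>a b. coeff_mat g i $ a $ b \<in> ideal_power Sigma_ideal (2 * 2 ^ (k - 2)))"
proof -
  have "generate GL2 {embed_mat M1, embed_mat M2T} \<subseteq> level0"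
    using embed_mat_M1_in_level0 embed_mat_M2T_in_level0
    by (intro group.generate_subgroup_incl[OF group_GL2 _ subgroup_level0]) simp
  then have "embed_mat ` Fderived k \<subseteq> (derived GL2 ^^ k) level0"
    unfolding embed_mat_image_Fderived by (rule group.mono_exp_of_derived[OF group_GL2])
  also have "\<dots> \<subseteq> congruence_subgroup (filtration (2 ^ (k - 2)))"
    using assms(1) by (intro iterated_derived_level0) simp
  finally have "embed_mat g
      \<in> congruence_subgroup (fps_ideal (ideal_power Sigma_ideal (2 * 2 ^ (k - 2))) (2 ^ (k - 2)))"
    using assms(2) by (auto simp: filtration_def)
  moreover have "coeff_mat g i = map_matrix (\<lambda>f. fps_nth f i) (embed_mat g)" for i
    by (simp add: coeff_mat_def map_matrix_def)
  ultimately show ?thesis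
    using coefficients_of_congruence_subgroup[of "embed_mat g"] by simp
qed

end
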